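(* Let $\Gamma=(V\uplus A,E,\alpha,c,\lambda)$ be a gainy marked network with all sinks marked. Then the transfer map $\phi_\Gamma\colon\mathbb{R}^V\to\mathbb{R}^V$, $$\phi_\Gamma(x)_v = x_v-\max_{v\xrightarrow{e}w}(\alpha_e x_w+c_e)\quad (v\in V),$$ is a piecewise-linear bijection with inverse $\psi_\Gamma\colon\mathbb{R}^V\to\mathbb{R}^V$ given by $$\psi_\Gamma(y)_v = \sup_{W\in\mathcal{W}_v}\Sigma(W)(y)\quad (v\in V).$$
   Context: A marked network $\Gamma=(V\uplus A,E,\alpha,c,\lambda)$ consists of a finite loop-free directed multigraph on the node set $V\uplus A$ with edge set $E$ (nodes in $A$ are called marked, nodes in $V$ unmarked), weights $\alpha_e,c_e\in\mathbb{R}$ with $\alpha_e>0$ for each edge $e\in E$, and a marking $\lambda\in\mathbb{R}^A$. For $x\in\mathbb{R}^V$ one sets $x_a:=\lambda_a$ for $a\in A$. A sink is a node without outgoing edges; "all sinks marked" means every sink lies in $A$. In the definition of $\phi_\Gamma$ the maximum is over all edges $e$ starting in $v$ (with $w$ the end node of $e$). A cycle is a finite walk $v_1\xrightarrow{e_1}v_2\to\cdots\xrightarrow{e_r}v_{r+1}=v_1$ ($r\ge 1$) with $v_1,\dots,v_r$ pairwise distinct. The weight of a finite walk with edges $e_1,\dots,e_r$ is $\prod_{i=1}^r\alpha_{e_i}$. The network is gainy if every cycle $C$ has weight $\alpha(C)<1$. $\mathcal{W}$ is the set consisting of all finite walks $v_1\xrightarrow{e_1}\cdots\xrightarrow{e_r}v_{r+1}$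 ($r\ge0$) with $v_i\in V$ for $i\le r$ and $v_{r+1}\in A$, and all infinite walks $v_1\xrightarrow{e_1}v_2\xrightarrow{e_2}\cdots$ with all $v_i\in V$. $\mathcal{W}_v$ is the set of walks in $\mathcal{W}$ starting in $v$. For $W\in\mathcal{W}$ and $x\in\mathbb{R}^V$: if $W$ is finite, $$\Sigma(W)(x)=\sum_{k=1}^r\Big(\prod_{j=1}^{k-1}\alpha_{e_j}\Big)(x_{v_k}+c_{e_k})+\Big(\prod_{j=1}^r\alpha_{e_j}\Big)x_{v_{r+1}};$$ if $W$ is infinite, $\Sigma(W)(x)=\sum_{k=1}^\infty\big(\prod_{j=1}^{k-1}\alpha_{e_j}\big)(x_{v_k}+c_{e_k})$ (for gainy networks this series converges absolutely, and for every $x$ the values $\Sigma(W)(x)$, $W\in\mathcal{W}$, are bounded above). "Piecewise-linear" means piecewise affine-linear. *)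

theory Defs
  imports Complex_Main "HOL-Library.FuncSet" "Graph_Theory.Arc_Walk"
begin

section \<open>Marked networks\<close>

record ('v, 'e) network =
  net_graph :: "('v, 'e) pre_digraph"
  marked :: "'v set"
  gain :: "'e \<Rightarrow> real"      \<comment> \<open>the weights \<open>\<alpha>\<close>\<close>
  offset :: "'e \<Rightarrow> real"    \<comment> \<open>the weights \<open>c\<close>\<close>
  marking :: "'v \<Rightarrow> real"   \<comment> \<open>\<open>\<lambda>\<close>, relevant on marked nodes only\<close>

abbreviation net_tail :: "('v, 'e) network \<Rightarrow> 'e \<Rightarrow> 'v" where
  "net_tail \<Gamma> \<equiv> tail (net_graph \<Gamma>)"

abbreviation net_head :: "('v, 'e) network \<Rightarrow> 'e \<Rightarrow> 'v" where
  "net_head \<Gamma> \<equiv> head (net_graph \<Gamma>)"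

locale marked_network =
  fin_digraph "net_graph \<Gamma>" + loopfree_digraph "net_graph \<Gamma>"
  for \<Gamma> :: "('v, 'e) network" +
  assumes marked_subset: "marked \<Gamma> \<subseteq> verts (net_graph \<Gamma>)"
    and gain_pos: "e \<in> arcs (net_graph \<Gamma>) \<Longrightarrow> gain \<Gamma> e > 0"

definition unmarked :: "('v, 'e) network \<Rightarrow> 'v set" where
  "unmarked \<Gamma> = verts (net_graph \<Gamma>) - marked \<Gamma>"

definition sink :: "('v, 'e) network \<Rightarrow> 'v \<Rightarrow> bool" where
  "sink \<Gamma> v \<longleftrightarrow> v \<in> verts (net_graph \<Gamma>) \<and> out_arcs (net_graph \<Gamma>) v = {}"

definition all_sinks_marked :: "('v, 'e) network \<Rightarrow> bool" where
  "all_sinks_marked \<Gamma> \<longleftrightarrow> (\<forall>v. sink \<Gamma> v \<longrightarrow> v \<in> marked \<Gamma>)"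

definition walk_gain :: "('v, 'e) network \<Rightarrow> 'e list \<Rightarrow> real" where
  "walk_gain \<Gamma> p = prod_list (map (gain \<Gamma>) p)"

definition gainy :: "('v, 'e) network \<Rightarrow> bool" where
  "gainy \<Gamma> \<longleftrightarrow> (\<forall>C. pre_digraph.cycle (net_graph \<Gamma>) C \<longrightarrow> walk_gain \<Gamma> C < 1)"


section \<open>Coordinate spaces and piecewise-linear maps\<close>

text \<open>\<open>\<real>\<^sup>V\<close> is represented by the functions that are \<^const>\<open>undefined\<close> outside \<open>V\<close>,
  so that equality in \<open>\<real>\<^sup>V\<close> is equality of functions. The set \<open>V\<close> may be empty.\<close>

definition coord_space :: "'v set \<Rightarrow> ('v \<Rightarrow> real) set" where
  "coord_space V = V \<rightarrow>\<^sub>E UNIV"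

definition halfspace :: "'v set \<Rightarrow> ('v \<Rightarrow> real) set \<Rightarrow> bool" where
  "halfspace V H \<longleftrightarrow> (\<exists>a b. H = {x \<in> coord_space V. (\<Sum>v\<in>V. a v * x v) \<le> b})"

text \<open>The empty intersection is the whole space.\<close>

definition polyhedral :: "'v set \<Rightarrow> ('v \<Rightarrow> real) set \<Rightarrow> bool" where
  "polyhedral V P \<longleftrightarrow>
     (\<exists>\<H>. finite \<H> \<and> (\<forall>H\<in>\<H>. halfspace V H) \<and> P = coord_space V \<inter> \<Inter>\<H>)"

definition affine_map_on ::
    "'v set \<Rightarrow> ('v \<Rightarrow> real) set \<Rightarrow> (('v \<Rightarrow> real) \<Rightarrow> ('v \<Rightarrow> real)) \<Rightarrow> bool" where
  "affine_map_on V P f \<longleftrightarrow>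
     (\<exists>M b. \<forall>x\<in>P. \<forall>v\<in>V. f x v = (\<Sum>u\<in>V. M v u * x u) + b v)"

text \<open>The pieces are closed polyhedra, so a piecewise-linear map is continuous.\<close>

definition piecewise_linear ::
    "'v set \<Rightarrow> (('v \<Rightarrow> real) \<Rightarrow> ('v \<Rightarrow> real)) \<Rightarrow> bool" where
  "piecewise_linear V f \<longleftrightarrow> f \<in> coord_space V \<rightarrow> coord_space V \<and>
     (\<exists>\<P>. finite \<P> \<and> \<Union>\<P> = coord_space V \<and>
        (\<forall>P\<in>\<P>. polyhedral V P \<and> affine_map_on V P f))"


section \<open>The transfer map\<close>

text \<open>The convention \<open>x\<^sub>a = \<lambda>\<^sub>a\<close> for marked nodes \<open>a\<close>.\<close>

definition node_val :: "('v, 'e) network \<Rightarrow> ('v \<Rightarrow> real) \<Rightarrow> 'v \<Rightarrow> real" where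
  "node_val \<Gamma> x v = (if v \<in> marked \<Gamma> then marking \<Gamma> v else x v)"

definition transfer_map :: "('v, 'e) network \<Rightarrow> ('v \<Rightarrow> real) \<Rightarrow> ('v \<Rightarrow> real)" where
  "transfer_map \<Gamma> x = (\<lambda>v \<in> unmarked \<Gamma>.
     x v - Max ((\<lambda>e. gain \<Gamma> e * node_val \<Gamma> x (net_head \<Gamma> e) + offset \<Gamma> e)
                  ` out_arcs (net_graph \<Gamma>) v))"


section \<open>Walks and their sums\<close>

text \<open>Finite walks carry their start node because their edge list may be empty.\<close>

datatype ('v, 'e) walk = Finite_Walk 'v "'e list" | Infinite_Walk "nat \<Rightarrow> 'e"

definition finite_walks :: "('v, 'e) network \<Rightarrow> ('v, 'e) walk set" where
  "finite_walks \<Gamma> = {Finite_Walk u p | u p.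
     \<exists>a\<in>marked \<Gamma>. pre_digraph.awalk (net_graph \<Gamma>) u p a
       \<and> (\<forall>e\<in>set p. net_tail \<Gamma> e \<in> unmarked \<Gamma>)}"

definition infinite_walks :: "('v, 'e) network \<Rightarrow> ('v, 'e) walk set" where
  "infinite_walks \<Gamma> = {Infinite_Walk e | e.
     \<forall>k. e k \<in> arcs (net_graph \<Gamma>) \<and> net_tail \<Gamma> (e k) \<in> unmarked \<Gamma>
       \<and> net_head \<Gamma> (e k) = net_tail \<Gamma> (e (Suc k))}"

definition walks :: "('v, 'e) network \<Rightarrow> ('v, 'e) walk set" where
  "walks \<Gamma> = finite_walks \<Gamma> \<union> infinite_walks \<Gamma>"

fun walk_start :: "('v, 'e) network \<Rightarrow> ('v, 'e) walk \<Rightarrow> 'v" where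
  "walk_start \<Gamma> (Finite_Walk u p) = u"
| "walk_start \<Gamma> (Infinite_Walk e) = net_tail \<Gamma> (e 0)"

definition walks_from :: "('v, 'e) network \<Rightarrow> 'v \<Rightarrow> ('v, 'e) walk set" where
  "walks_from \<Gamma> v = {W \<in> walks \<Gamma>. walk_start \<Gamma> W = v}"

text \<open>Edges are indexed from 0 here.\<close>

definition walk_term ::
    "('v, 'e) network \<Rightarrow> ('v \<Rightarrow> real) \<Rightarrow> (nat \<Rightarrow> 'e) \<Rightarrow> nat \<Rightarrow> real" where
  "walk_term \<Gamma> x e k =
     (\<Prod>j<k. gain \<Gamma> (e j)) * (node_val \<Gamma> x (net_tail \<Gamma> (e k)) + offset \<Gamma> (e k))"

fun walk_sum :: "('v, 'e) network \<Rightarrow> ('v \<Rightarrow> real) \<Rightarrow> ('v, 'e) walk \<Rightarrow> real" where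
  "walk_sum \<Gamma> x (Finite_Walk u p) =
     (\<Sum>k<length p. walk_term \<Gamma> x (\<lambda>i. p ! i) k)
       + walk_gain \<Gamma> p * node_val \<Gamma> x (pre_digraph.awlast (net_graph \<Gamma>) u p)"
| "walk_sum \<Gamma> x (Infinite_Walk e) = (\<Sum>k. walk_term \<Gamma> x e k)"

definition walk_sup_map :: "('v, 'e) network \<Rightarrow> ('v \<Rightarrow> real) \<Rightarrow> ('v \<Rightarrow> real)" where
  "walk_sup_map \<Gamma> y = (\<lambda>v \<in> unmarked \<Gamma>. SUP W \<in> walks_from \<Gamma> v. walk_sum \<Gamma> y W)"

text \<open>\<^const>\<open>suminf\<close> and the supremum of reals are total operators; this says that in
  \<^const>\<open>walk_sup_map\<close> they denote genuine sums and suprema.\<close>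

definition walk_sup_well_defined :: "('v, 'e) network \<Rightarrow> bool" where
  "walk_sup_well_defined \<Gamma> \<longleftrightarrow> (\<forall>y \<in> coord_space (unmarked \<Gamma>).
     (\<forall>e. Infinite_Walk e \<in> walks \<Gamma> \<longrightarrow> summable (\<lambda>k. \<bar>walk_term \<Gamma> y e k\<bar>)) \<and>
     (\<forall>v \<in> unmarked \<Gamma>. walks_from \<Gamma> v \<noteq> {} \<and> bdd_above (walk_sum \<Gamma> y ` walks_from \<Gamma> v)))"

end

theory Submission
  imports Defs
begin

text \<open>
  Since there are finitely many cycles, the gains divided by some \<open>q < 1\<close> still have weight at
  most 1 on every cycle. Hence the largest weight \<open>h v\<close> of a path starting in \<open>v\<close>, computed with
  these divided gains, satisfies \<open>\<alpha>\<^sub>e h w \<le> q h v\<close> for every edge \<open>e\<close> from \<open>v\<close> to \<open>w\<close>. In the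
  supremum norm weighted by \<open>h\<close> the equation \<open>\<phi> x = y\<close> is a fixed point equation for a
  contraction, so \<open>\<phi>\<close> is injective, and large multiples of \<open>h\<close> bound all walk sums. Splitting
  off the first edge of a walk gives the Bellman equation
  \<open>\<psi>(y)\<^sub>v = y\<^sub>v + max\<^sub>e (\<alpha>\<^sub>e \<psi>(y)\<^sub>w + c\<^sub>e)\<close>, that is, \<open>\<phi> (\<psi> y) = y\<close>.
\<close>

section \<open>Maxima and path potentials on finite digraphs\<close>

text \<open>A maximiser \<open>e\<close> of \<open>f\<close> works, since \<open>g e\<close> cannot
  exceed the maximum of \<open>g\<close>. This reduces a difference of two maxima to a single
  edge.\<close>

lemma Max_image_diff_le:
  fixes f g :: "'a \<Rightarrow> 'b::linordered_ab_group_add"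
  assumes "finite A" "A \<noteq> {}"
  obtains e where "e \<in> A" "Max (f ` A) - Max (g ` A) \<le> f e - g e"
proof -
  have "Max (f ` A) \<in> f ` A" using assms by simp
  then obtain e where e: "e \<in> A" "Max (f ` A) = f e" by auto
  have "g e \<le> Max (g ` A)" using assms e(1) by simp
  then show thesis using that e by simp
qed

lemma prod_list_map_divide_const:
  fixes f :: "'a \<Rightarrow> 'b::field"
  shows "prod_list (map (\<lambda>e. f e / c) p) = prod_list (map f p) / c ^ length p"
  by (induction p) simp_all

text \<open>A cycle repeats no arc, so its length is at most the number of arcs.\<close>

lemma (in fin_digraph) finite_cycles: "finite {C. cycle C}"
proof (rule finite_subset)
  show "{C. cycle C} \<subseteq> {C. set C \<subseteq> arcs G \<and> length C \<le> card (arcs G)}"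
  proof clarify
    fix C assume "cycle C"
    then obtain u where "awalk u C u" "distinct C" unfolding cycle_conv by blast
    then have "set C \<subseteq> arcs G" "length C = card (set C)"
      by (auto simp: awalk_def distinct_card)
    then show "set C \<subseteq> arcs G \<and> length C \<le> card (arcs G)"
      by (simp add: card_mono)
  qed
  show "finite {C. set C \<subseteq> arcs G \<and> length C \<le> card (arcs G)}"
    using finite_arcs by (rule finite_lists_length_le)
qed

lemma (in fin_digraph) path_potential_exists:
  fixes g :: "'b \<Rightarrow> real"
  assumes pos: "\<And>e. e \<in> arcs G \<Longrightarrow> 0 < g e"
    and cyc: "\<And>C. cycle C \<Longrightarrow> prod_list (map g C) \<le> 1"
  obtains h where "\<And>v. v \<in> verts G \<Longrightarrow> 1 \<le> h v"
    "\<And>e. e \<in> arcs G \<Longrightarrow> g e * h (head G e) \<le> h (tail G e)"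
proof -
  define w where "w p = prod_list (map g p)" for p
  have w_pos: "0 < w p" if "set p \<subseteq> arcs G" for p
    using that unfolding w_def by (induction p) (auto simp: pos)
  \<comment> \<open>Paths instead of walks keep this set finite, so that the maximum below
    exists.\<close>
  define P where "P v = {p. \<exists>u. apath v p u}" for v
  define h where "h v = Max (w ` P v)" for v
  have fin: "finite (P v)" for v
  proof (rule finite_subset)
    show "P v \<subseteq> (\<lambda>(u, p, v). p) ` {(u, p, v). apath u p v}"
      unfolding P_def by (force simp: image_iff)
    show "finite ((\<lambda>(u, p, v). p) ` {(u, p, v). apath u p v})"
      using apaths_finite_triple by simp
  qed
  have Nil: "[] \<in> P v" if "v \<in> verts G" for v
    using that unfolding P_def by (auto simp: apath_Nil_iff)
  have w_le: "w p \<le> h v" if "p \<in> P v" for p v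
    using that fin unfolding h_def by simp
  show thesis
  proof
    show "1 \<le> h v" if "v \<in> verts G" for v
      using w_le[OF Nil[OF that]] by (simp add: w_def)
    show "g e * h (head G e) \<le> h (tail G e)" if e: "e \<in> arcs G" for e
    proof -
      have "h (head G e) \<in> w ` P (head G e)"
        unfolding h_def using fin Nil[of "head G e"] e by (intro Max_in) auto
      then obtain p u where p: "apath (head G e) p u" "h (head G e) = w p"
        unfolding P_def by auto
      have "w (e # p) \<le> h (tail G e)"
      proof (cases "tail G e \<in> set (awalk_verts (head G e) p)")
        case False
        then have "e # p \<in> P (tail G e)"
          using p(1) e unfolding P_def by (auto simp: apath_Cons_iff)
        then show ?thesis by (rule w_le)
      next
        case True
        \<comment> \<open>The tail of \<open>e\<close> already lies on \<open>p\<close>: cut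
          \<open>p\<close> there into \<open>r\<close> and \<open>s\<close>, so that
          \<open>e # r\<close> is a cycle and \<open>s\<close> is a path from the tail of
          \<open>e\<close>.\<close>
        have walk: "awalk (head G e) p u" using p(1) by (rule awalkI_apath)
        then obtain r s where rs: "p = r @ s" "awalk (head G e) r (tail G e)"
          "awalk (tail G e) s u"
          using awalk_decomp[OF _ True] by blast
        have last: "awlast (head G e) r = tail G e" using rs(2) by simp
        have paths: "apath (head G e) r (tail G e)" "apath (tail G e) s u"
          using p(1) unfolding rs(1) apath_append_iff last by auto
        have "awalk (tail G e) (e # r) (tail G e)"
          using rs(2) e by (simp add: awalk_Cons_iff)
        moreover have "distinct (tl (awalk_verts (tail G e) (e # r)))"
          using paths(1) by (simp add: apath_def)
        ultimately have "cycle (e # r)" unfolding cycle_def by blast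
        then have "w (e # r) \<le> 1" unfolding w_def by (rule cyc)
        moreover have "0 < w s" using rs(3) by (intro w_pos) auto
        ultimately have "w (e # r) * w s \<le> w s"
          by (simp add: mult_left_le_one_le mult_le_cancel_right2)
        also have "\<dots> \<le> h (tail G e)"
          using paths(2) by (intro w_le) (auto simp: P_def)
        finally show ?thesis unfolding rs(1) w_def by simp
      qed
      then show ?thesis using p(2) by (simp add: w_def)
    qed
  qed
qed

section \<open>Gainy networks and their contraction potential\<close>

locale gainy_network = marked_network \<Gamma> for \<Gamma> :: "('v, 'e) network" +
  assumes gainy: "gainy \<Gamma>"
    and all_sinks_marked: "all_sinks_marked \<Gamma>"
begin

abbreviation "G \<equiv> net_graph \<Gamma>"
abbreviation "V \<equiv> unmarked \<Gamma>"
abbreviation "out v \<equiv> out_arcs G v"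

lemma finite_V: "finite V"
  by (simp add: unmarked_def)

lemma finite_out: "finite (out v)"
  by (rule finite_subset[OF _ finite_arcs]) auto

lemma out_nonempty: "v \<in> V \<Longrightarrow> out v \<noteq> {}"
  using all_sinks_marked by (auto simp: all_sinks_marked_def sink_def unmarked_def)

text \<open>As \<open>q\<close> tends to 1 from below, \<open>q ^ length C\<close> tends to 1, which
  exceeds the gain of \<open>C\<close>; finitely many cycles admit a common
  \<open>q\<close>.\<close>

lemma cycle_gain_bound:
  obtains q where "0 < q" "q < 1" "\<And>C. cycle C \<Longrightarrow> walk_gain \<Gamma> C < q ^ length C"
proof -
  have "eventually (\<lambda>q. walk_gain \<Gamma> C < q ^ length C) (at_left (1::real))" if "cycle C" for C
  proof (rule order_tendstoD(1))
    have "((\<lambda>q. q ^ length C) \<longlongrightarrow> 1 ^ length C) (at_left (1::real))"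
      by (intro tendsto_intros)
    then show "((\<lambda>q. q ^ length C) \<longlongrightarrow> 1) (at_left (1::real))" by simp
    show "walk_gain \<Gamma> C < 1" using gainy that by (auto simp: gainy_def)
  qed
  then have "eventually (\<lambda>q. \<forall>C\<in>{C. cycle C}. walk_gain \<Gamma> C < q ^ length C) (at_left (1::real))"
    using finite_cycles by (intro eventually_ball_finite) auto
  moreover have "eventually (\<lambda>q. q \<in> {0<..<1}) (at_left (1::real))"
    by (rule eventually_at_left_real) simp
  ultimately have "eventually (\<lambda>q. q \<in> {0<..<1} \<and> (\<forall>C\<in>{C. cycle C}. walk_gain \<Gamma> C < q ^ length C))
      (at_left (1::real))"
    by (simp add: eventually_conj_iff)
  then obtain q where "q \<in> {0<..<1} \<and> (\<forall>C\<in>{C. cycle C}. walk_gain \<Gamma> C < q ^ length C)"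
    using eventually_happens'[OF trivial_limit_at_left_real] by blast
  then show thesis using that[of q] by auto
qed

text \<open>This is the path potential of the gains divided by \<open>q\<close>: these have weight
  at most 1 on every cycle, and the factor \<open>q\<close> reappears as the contraction rate along
  edges.\<close>

lemma potential_exists:
  obtains q h where "0 < q" "q < (1::real)" "\<And>v. v \<in> verts G \<Longrightarrow> 1 \<le> h v"
    "\<And>e. e \<in> arcs G \<Longrightarrow> gain \<Gamma> e * h (net_head \<Gamma> e) \<le> q * h (net_tail \<Gamma> e)"
proof -
  obtain q where q: "0 < q" "q < 1" "\<And>C. cycle C \<Longrightarrow> walk_gain \<Gamma> C < q ^ length C"
    by (rule cycle_gain_bound) blast
  obtain h where h: "\<And>v. v \<in> verts G \<Longrightarrow> 1 \<le> h v"
    "\<And>e. e \<in> arcs G \<Longrightarrow> gain \<Gamma> e / q * h (net_head \<Gamma> e) \<le> h (net_tail \<Gamma> e)"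
  proof (rule path_potential_exists)
    show "0 < gain \<Gamma> e / q" if "e \<in> arcs G" for e
      using gain_pos[OF that] q(1) by simp
    show "prod_list (map (\<lambda>e. gain \<Gamma> e / q) C) \<le> 1" if "cycle C" for C
      using q(3)[OF that] q(1)
      by (simp add: prod_list_map_divide_const walk_gain_def divide_le_eq)
  qed blast
  show thesis
    by (rule that[of q h]) (use q h in \<open>auto simp: field_simps\<close>)
qed

section \<open>Injectivity of the transfer map\<close>

lemma transfer_map_apply:
  assumes "v \<in> V"
  shows "transfer_map \<Gamma> x v
    = x v - Max ((\<lambda>e. gain \<Gamma> e * node_val \<Gamma> x (net_head \<Gamma> e) + offset \<Gamma> e) ` out v)"
  using assms by (simp add: transfer_map_def)

lemma transfer_map_coord: "transfer_map \<Gamma> x \<in> coord_space V"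
  by (simp add: transfer_map_def coord_space_def)

lemma node_val_unmarked: "v \<in> V \<Longrightarrow> node_val \<Gamma> x v = x v"
  by (simp add: node_val_def unmarked_def)

text \<open>Equal images turn \<open>x v - x' v\<close> into a difference of two maxima, which is
  bounded at a single edge, where the offsets cancel.\<close>

lemma node_diff_le:
  assumes "v \<in> V" "transfer_map \<Gamma> x = transfer_map \<Gamma> x'"
  obtains e where "e \<in> out v"
    "x v - x' v \<le> gain \<Gamma> e * (node_val \<Gamma> x (net_head \<Gamma> e) - node_val \<Gamma> x' (net_head \<Gamma> e))"
proof -
  let ?f = "\<lambda>x e. gain \<Gamma> e * node_val \<Gamma> x (net_head \<Gamma> e) + offset \<Gamma> e"
  have "x v - x' v = Max (?f x ` out v) - Max (?f x' ` out v)"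
    using transfer_map_apply[OF assms(1), of x] transfer_map_apply[OF assms(1), of x'] assms(2)
    by simp
  moreover obtain e where "e \<in> out v"
    "Max (?f x ` out v) - Max (?f x' ` out v) \<le> ?f x e - ?f x' e"
    by (rule Max_image_diff_le[OF finite_out out_nonempty[OF assms(1)], of "?f x" "?f x'"])
  ultimately show thesis using that by (simp add: right_diff_distrib)
qed

text \<open>The largest \<open>h\<close>-weighted distance \<open>D\<close> is attained at some
  node: at a marked node it is zero, and at an unmarked one the contraction gives
  \<open>D <= q * D\<close>. Hence \<open>D <= 0\<close> and all distances vanish.\<close>

lemma inj_on_transfer_map: "inj_on (transfer_map \<Gamma>) (coord_space V)"
proof (rule inj_onI)
  fix x x' assume coord: "x \<in> coord_space V" "x' \<in> coord_space V"
    and eq: "transfer_map \<Gamma> x = transfer_map \<Gamma> x'"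
  obtain q h where q: "0 < q" "q < (1::real)" and h1: "\<And>v. v \<in> verts G \<Longrightarrow> 1 \<le> h v"
    and h: "\<And>e. e \<in> arcs G \<Longrightarrow> gain \<Gamma> e * h (net_head \<Gamma> e) \<le> q * h (net_tail \<Gamma> e)"
    by (rule potential_exists) blast
  \<comment> \<open>Using \<open>node_val\<close> extends the distance to all nodes, with value 0 on
    marked ones.\<close>
  define d where "d v = \<bar>node_val \<Gamma> x v - node_val \<Gamma> x' v\<bar>" for v
  define D where "D = Max ((\<lambda>v. d v / h v) ` verts G)"
  have d_le: "d v \<le> D * h v" if "v \<in> verts G" for v
  proof -
    have "d v / h v \<le> D" unfolding D_def using that by simp
    then show ?thesis using h1[OF that] by (simp add: divide_le_eq)
  qed
  have step: "\<exists>e\<in>out v. d v \<le> gain \<Gamma> e * d (net_head \<Gamma> e)" if v: "v \<in> V" for v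
  proof (cases "x v \<ge> x' v")
    case True
    obtain e where e: "e \<in> out v"
      "x v - x' v \<le> gain \<Gamma> e * (node_val \<Gamma> x (net_head \<Gamma> e) - node_val \<Gamma> x' (net_head \<Gamma> e))"
      by (rule node_diff_le[OF v eq])
    note e(2)
    also have "\<dots> \<le> gain \<Gamma> e * d (net_head \<Gamma> e)"
      using gain_pos[of e] e(1) unfolding d_def by (intro mult_left_mono) auto
    finally show ?thesis using e(1) True v by (auto simp: d_def node_val_unmarked)
  next
    case False
    \<comment> \<open>Swapping \<open>x\<close> and \<open>x'\<close> handles the other sign of the
      absolute value.\<close>
    obtain e where e: "e \<in> out v"
      "x' v - x v \<le> gain \<Gamma> e * (node_val \<Gamma> x' (net_head \<Gamma> e) - node_val \<Gamma> x (net_head \<Gamma> e))"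
      by (rule node_diff_le[OF v eq[symmetric]])
    note e(2)
    also have "\<dots> \<le> gain \<Gamma> e * d (net_head \<Gamma> e)"
      using gain_pos[of e] e(1) unfolding d_def by (intro mult_left_mono) auto
    finally show ?thesis using e(1) False v by (auto simp: d_def node_val_unmarked)
  qed
  have d0: "d v = 0" if "v \<in> verts G" for v
  proof -
    \<comment> \<open>The given node \<open>v\<close> ensures that the maximum is not taken over the
      empty set.\<close>
    have "D \<in> (\<lambda>v. d v / h v) ` verts G"
      unfolding D_def using that by (intro Max_in) auto
    then obtain u where u: "u \<in> verts G" "D = d u / h u" by auto
    have du: "d u = D * h u" using u h1[of u] by simp
    have "D \<le> 0"
    proof (cases "u \<in> marked \<Gamma>")
      case True
      then show ?thesis using u(2) by (simp add: d_def node_val_def)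
    next
      case False
      then have "u \<in> V" using u(1) by (simp add: unmarked_def)
      then obtain e where e: "e \<in> out u" "d u \<le> gain \<Gamma> e * d (net_head \<Gamma> e)"
        using step by blast
      have arc: "e \<in> arcs G" "net_tail \<Gamma> e = u" using e(1) by auto
      have D0: "0 \<le> D" using u h1[of u] by (simp add: d_def)
      note e(2)
      also have "gain \<Gamma> e * d (net_head \<Gamma> e) \<le> gain \<Gamma> e * (D * h (net_head \<Gamma> e))"
        using arc(1) gain_pos[of e] d_le[of "net_head \<Gamma> e"] by (intro mult_left_mono) auto
      also have "\<dots> \<le> D * (q * h u)"
        using mult_left_mono[OF h[OF arc(1)] D0] arc(2) by (simp add: mult.left_commute)
      finally have "(1 - q) * (D * h u) \<le> 0" unfolding du by (simp add: algebra_simps)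
      then show ?thesis
        using q h1[OF u(1)] by (simp add: mult_le_0_iff)
    qed
    then have "D * h v \<le> 0" using h1[OF that] by (simp add: mult_nonpos_nonneg)
    then show ?thesis using d_le[OF that] by (simp add: d_def)
  qed
  have "x v = x' v" if "v \<in> V" for v
  proof -
    have "d v = 0" using that by (intro d0) (simp add: unmarked_def)
    then show ?thesis using that by (simp add: d_def node_val_unmarked)
  qed
  then show "x = x'"
    using coord unfolding coord_space_def by (intro PiE_ext) auto
qed

section \<open>Splitting walks at the first edge\<close>

text \<open>Meant for walks starting at the head of \<open>e\<close>; the old start node
  \<open>u\<close> can then be dropped, being determined by \<open>e\<close>.\<close>

fun walk_cons :: "'e \<Rightarrow> ('v, 'e) walk \<Rightarrow> ('v, 'e) walk" where
  "walk_cons e (Finite_Walk u p) = Finite_Walk (net_tail \<Gamma> e) (e # p)"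
| "walk_cons e (Infinite_Walk f) = Infinite_Walk (case_nat e f)"

lemma Finite_Walk_in_walks_from:
  "Finite_Walk u p \<in> walks_from \<Gamma> v \<longleftrightarrow>
     u = v \<and> (\<exists>a\<in>marked \<Gamma>. awalk v p a) \<and> (\<forall>e\<in>set p. net_tail \<Gamma> e \<in> V)"
  by (auto simp: walks_from_def walks_def finite_walks_def infinite_walks_def)

lemma Infinite_Walk_in_walks_from:
  "Infinite_Walk e \<in> walks_from \<Gamma> v \<longleftrightarrow> net_tail \<Gamma> (e 0) = v \<and>
     (\<forall>k. e k \<in> arcs G \<and> net_tail \<Gamma> (e k) \<in> V \<and> net_head \<Gamma> (e k) = net_tail \<Gamma> (e (Suc k)))"
  by (auto simp: walks_from_def walks_def finite_walks_def infinite_walks_def)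

text \<open>Edges of a walk leave unmarked nodes only, so nothing can follow a marked start.\<close>

lemma walks_from_marked:
  assumes "a \<in> marked \<Gamma>"
  shows "walks_from \<Gamma> a = {Finite_Walk a []}"
proof -
  have "W = Finite_Walk a []" if "W \<in> walks_from \<Gamma> a" for W
  proof (cases W)
    case (Finite_Walk u p)
    then show ?thesis
      using that assms
      by (cases p) (auto simp: Finite_Walk_in_walks_from awalk_Cons_iff unmarked_def)
  next
    case (Infinite_Walk f)
    then show ?thesis
      using that assms by (auto simp: Infinite_Walk_in_walks_from unmarked_def)
  qed
  moreover have "Finite_Walk a [] \<in> walks_from \<Gamma> a"
    using assms marked_subset by (auto simp: Finite_Walk_in_walks_from awalk_Nil_iff)
  ultimately show ?thesis by blast
qed

lemma walk_cons_in_walks_from: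
  assumes "v \<in> V" "e \<in> out v" "W \<in> walks_from \<Gamma> (net_head \<Gamma> e)"
  shows "walk_cons e W \<in> walks_from \<Gamma> v"
  using assms
  by (cases W)
    (auto simp: Finite_Walk_in_walks_from Infinite_Walk_in_walks_from awalk_Cons_iff
      split: nat.split)

text \<open>Converse of \<open>walk_cons_in_walks_from\<close>. A walk from an unmarked node is
  never empty, because finite walks end in marked nodes.\<close>

lemma walks_from_unmarked_cases:
  assumes "v \<in> V" "W \<in> walks_from \<Gamma> v"
  obtains e W' where "e \<in> out v" "W' \<in> walks_from \<Gamma> (net_head \<Gamma> e)" "W = walk_cons e W'"
proof (cases W)
  case (Finite_Walk u p)
  with assms obtain e p' where "p = e # p'"
    by (cases p) (auto simp: Finite_Walk_in_walks_from awalk_Nil_iff unmarked_def)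
  then show thesis
    using assms Finite_Walk
    by (intro that[of e "Finite_Walk (net_head \<Gamma> e) p'"])
      (auto simp: Finite_Walk_in_walks_from awalk_Cons_iff)
next
  case (Infinite_Walk f)
  then show thesis
    using assms
    by (intro that[of "f 0" "Infinite_Walk (\<lambda>k. f (Suc k))"])
      (auto simp: Infinite_Walk_in_walks_from fun_eq_iff split: nat.split)
qed

text \<open>Follow one chosen outgoing edge per unmarked node: the trajectory either reaches a
  marked node or is itself an infinite walk. Suprema over walks thus range over nonempty
  sets.\<close>

lemma walks_from_nonempty:
  assumes "v \<in> verts G"
  shows "walks_from \<Gamma> v \<noteq> {}"
proof -
  define \<sigma> where "\<sigma> u = (SOME e. e \<in> out u)" for u
  have \<sigma>: "\<sigma> u \<in> out u" if "u \<in> V" for u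
    unfolding \<sigma>_def using out_nonempty[OF that] by (subst some_in_eq)
  define n where "n k u = ((\<lambda>u. net_head \<Gamma> (\<sigma> u)) ^^ k) u" for k u
  show ?thesis
  proof (cases "\<exists>k. n k v \<in> marked \<Gamma>")
    case True
    then obtain k where "n k v \<in> marked \<Gamma>" by blast
    then show ?thesis using assms
    proof (induction k arbitrary: v)
      case 0
      then show ?case by (simp add: n_def walks_from_marked)
    next
      case (Suc k)
      show ?case
      proof (cases "v \<in> marked \<Gamma>")
        case True
        then show ?thesis by (simp add: walks_from_marked)
      next
        case False
        then have v: "v \<in> V" using Suc.prems by (simp add: unmarked_def)
        have "net_head \<Gamma> (\<sigma> v) \<in> verts G" using \<sigma>[OF v] by simp
        \<comment> \<open>The iterate is unrolled at its inner end, so that the shorter trajectory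
          starts at the successor of \<open>v\<close>.\<close>
        moreover have "n k (net_head \<Gamma> (\<sigma> v)) \<in> marked \<Gamma>"
          using Suc.prems(1) by (simp only: n_def funpow_Suc_right o_apply)
        ultimately obtain W where "W \<in> walks_from \<Gamma> (net_head \<Gamma> (\<sigma> v))"
          using Suc.IH by blast
        then show ?thesis using walk_cons_in_walks_from[OF v \<sigma>[OF v]] by blast
      qed
    qed
  next
    case False
    then have not_marked: "n k v \<notin> marked \<Gamma>" for k by blast
    have n_V: "n k v \<in> V" for k
    proof (induction k)
      case 0
      then show ?case using assms not_marked[of 0] by (simp add: n_def unmarked_def)
    next
      case (Suc k)
      then have "n (Suc k) v \<in> verts G" using \<sigma>[OF Suc] by (simp add: n_def)
      then show ?case using not_marked by (simp add: unmarked_def)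
    qed
    have "Infinite_Walk (\<lambda>k. \<sigma> (n k v)) \<in> walks_from \<Gamma> v"
      unfolding Infinite_Walk_in_walks_from
    proof (intro conjI allI)
      show "net_tail \<Gamma> (\<sigma> (n 0 v)) = v" using \<sigma>[OF n_V, of 0] by (simp add: n_def)
      fix k
      show "\<sigma> (n k v) \<in> arcs G" "net_tail \<Gamma> (\<sigma> (n k v)) \<in> V"
        using \<sigma>[OF n_V, of k] n_V[of k] by auto
      show "net_head \<Gamma> (\<sigma> (n k v)) = net_tail \<Gamma> (\<sigma> (n (Suc k) v))"
        using \<sigma>[OF n_V, of "Suc k"] by (simp add: n_def)
    qed
    then show ?thesis by blast
  qed
qed

section \<open>Convergence, recursion and bounds for walk sums\<close>

lemma walk_term_Suc:
  "walk_term \<Gamma> y f (Suc k) = gain \<Gamma> (f 0) * walk_term \<Gamma> y (\<lambda>k. f (Suc k)) k"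
  by (simp add: walk_term_def prod.lessThan_Suc_shift mult.assoc del: prod.lessThan_Suc)

lemma walk_sum_Finite_Cons:
  assumes "net_tail \<Gamma> e = u"
  shows "walk_sum \<Gamma> y (Finite_Walk u (e # p))
    = node_val \<Gamma> y u + offset \<Gamma> e + gain \<Gamma> e * walk_sum \<Gamma> y (Finite_Walk (net_head \<Gamma> e) p)"
  using assms
  by (simp add: sum.lessThan_Suc_shift walk_term_Suc sum_distrib_left[symmetric] walk_gain_def
      walk_term_def[of _ _ _ 0] algebra_simps del: sum.lessThan_Suc)

text \<open>The sum over all arcs is taken as \<open>B\<close>; unlike a maximum, it also makes
  sense when there are no arcs.\<close>

lemma local_term_bound:
  obtains B where "0 \<le> B"
    "\<And>e. e \<in> arcs G \<Longrightarrow> \<bar>node_val \<Gamma> y (net_tail \<Gamma> e) + offset \<Gamma> e\<bar> \<le> B"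
proof
  let ?f = "\<lambda>e. \<bar>node_val \<Gamma> y (net_tail \<Gamma> e) + offset \<Gamma> e\<bar>"
  show "0 \<le> (\<Sum>e\<in>arcs G. ?f e)" by (simp add: sum_nonneg)
  show "?f e \<le> (\<Sum>e\<in>arcs G. ?f e)" if "e \<in> arcs G" for e
    using that by (intro member_le_sum) auto
qed

text \<open>The potential makes the partial gain products decay like \<open>q ^ k\<close>, while the
  other factor of each term is bounded by \<open>B\<close>. A geometric series dominates.\<close>

lemma walk_term_summable:
  assumes "Infinite_Walk e \<in> walks_from \<Gamma> v"
  shows "summable (\<lambda>k. \<bar>walk_term \<Gamma> y e k\<bar>)"
proof -
  obtain q h where q: "0 < q" "q < (1::real)" and h1: "\<And>v. v \<in> verts G \<Longrightarrow> 1 \<le> h v"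
    and h: "\<And>e. e \<in> arcs G \<Longrightarrow> gain \<Gamma> e * h (net_head \<Gamma> e) \<le> q * h (net_tail \<Gamma> e)"
    by (rule potential_exists) blast
  obtain B where B: "0 \<le> B"
    "\<And>e. e \<in> arcs G \<Longrightarrow> \<bar>node_val \<Gamma> y (net_tail \<Gamma> e) + offset \<Gamma> e\<bar> \<le> B"
    by (rule local_term_bound[of y]) blast
  have arc: "e k \<in> arcs G" and hd: "net_head \<Gamma> (e k) = net_tail \<Gamma> (e (Suc k))" for k
    using assms by (auto simp: Infinite_Walk_in_walks_from)
  define P where "P k = (\<Prod>j<k. gain \<Gamma> (e j))" for k
  have P0: "0 < P k" for k
    unfolding P_def by (intro prod_pos) (auto intro: gain_pos arc)
  \<comment> \<open>The potential inequality telescopes along the walk, one factor \<open>q\<close>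
    per edge.\<close>
  have P_h: "P k * h (net_tail \<Gamma> (e k)) \<le> q ^ k * h (net_tail \<Gamma> (e 0))" for k
  proof (induction k)
    case 0
    then show ?case by (simp add: P_def)
  next
    case (Suc k)
    have "P (Suc k) * h (net_tail \<Gamma> (e (Suc k))) = P k * (gain \<Gamma> (e k) * h (net_head \<Gamma> (e k)))"
      by (simp add: P_def hd)
    also have "\<dots> \<le> P k * (q * h (net_tail \<Gamma> (e k)))"
      using h[OF arc] P0[of k] by (intro mult_left_mono) auto
    also have "\<dots> = q * (P k * h (net_tail \<Gamma> (e k)))" by simp
    also have "\<dots> \<le> q * (q ^ k * h (net_tail \<Gamma> (e 0)))"
      using Suc q by (intro mult_left_mono) auto
    finally show ?case by (simp add: mult.assoc)
  qed
  have bound: "\<bar>walk_term \<Gamma> y e k\<bar> \<le> (h (net_tail \<Gamma> (e 0)) * B) * q ^ k" for k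
  proof -
    have "\<bar>walk_term \<Gamma> y e k\<bar> = P k * \<bar>node_val \<Gamma> y (net_tail \<Gamma> (e k)) + offset \<Gamma> (e k)\<bar>"
      using P0[of k] by (simp add: walk_term_def P_def abs_mult)
    also have "\<dots> \<le> P k * B" using P0[of k] B(2)[OF arc] by (intro mult_left_mono) auto
    \<comment> \<open>Since \<open>h\<close> is at least 1, the potential can be inserted, and then
      \<open>P_h\<close> applies.\<close>
    also have "\<dots> \<le> P k * h (net_tail \<Gamma> (e k)) * B"
      using P0[of k] B(1) h1[of "net_tail \<Gamma> (e k)"] arc[of k]
      by (intro mult_right_mono) auto
    also have "\<dots> \<le> q ^ k * h (net_tail \<Gamma> (e 0)) * B"
      using P_h B(1) by (intro mult_right_mono) auto
    finally show ?thesis by (simp add: mult_ac)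
  qed
  have "summable (\<lambda>k. (h (net_tail \<Gamma> (e 0)) * B) * q ^ k)"
    using q by (intro summable_mult summable_geometric) auto
  then show ?thesis
    by (rule summable_comparison_test'[where N = 0]) (use bound in simp)
qed

text \<open>One step of the Bellman recursion. For infinite walks, summability justifies splitting
  off the first term and pulling out the gain.\<close>

lemma walk_sum_walk_cons:
  assumes "v \<in> V" "e \<in> out v" "W \<in> walks_from \<Gamma> (net_head \<Gamma> e)"
  shows "walk_sum \<Gamma> y (walk_cons e W) = y v + offset \<Gamma> e + gain \<Gamma> e * walk_sum \<Gamma> y W"
proof (cases W)
  case (Finite_Walk u p)
  have "net_tail \<Gamma> e = v" "u = net_head \<Gamma> e"
    using assms Finite_Walk by (auto simp: Finite_Walk_in_walks_from)
  then show ?thesis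
    using Finite_Walk walk_sum_Finite_Cons[of e v y p] assms(1)
    by (simp add: node_val_unmarked del: walk_sum.simps)
next
  case (Infinite_Walk f)
  let ?t = "walk_term \<Gamma> y (case_nat e f)"
  have Suc: "?t (Suc k) = gain \<Gamma> e * walk_term \<Gamma> y f k" for k
    by (simp add: walk_term_Suc)
  have "Infinite_Walk (case_nat e f) \<in> walks_from \<Gamma> v"
    using walk_cons_in_walks_from[OF assms] Infinite_Walk by simp
  then have "summable (\<lambda>k. \<bar>?t k\<bar>)" by (rule walk_term_summable)
  then have "summable ?t" by (rule summable_rabs_cancel)
  then have "suminf ?t = ?t 0 + (\<Sum>k. ?t (Suc k))"
    by (simp add: suminf_split_head)
  moreover have "summable (walk_term \<Gamma> y f)"
    using assms(3) Infinite_Walk walk_term_summable summable_rabs_cancel by blast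
  moreover have "?t 0 = y v + offset \<Gamma> e"
    using assms(1,2) by (auto simp: walk_term_def node_val_unmarked)
  ultimately show ?thesis
    using Infinite_Walk by (simp add: Suc suminf_mult)
qed

text \<open>The function \<open>K * h\<close> dominates the markings, and the bound persists when an
  edge is prepended. Induction covers finite walks and the partial sums of infinite ones.\<close>

lemma bdd_above_walk_sum: "bdd_above (walk_sum \<Gamma> y ` walks_from \<Gamma> v)"
proof -
  obtain q h where q: "0 < q" "q < (1::real)" and h1: "\<And>v. v \<in> verts G \<Longrightarrow> 1 \<le> h v"
    and h: "\<And>e. e \<in> arcs G \<Longrightarrow> gain \<Gamma> e * h (net_head \<Gamma> e) \<le> q * h (net_tail \<Gamma> e)"
    by (rule potential_exists) blast
  obtain B where B: "0 \<le> B"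
    "\<And>e. e \<in> arcs G \<Longrightarrow> \<bar>node_val \<Gamma> y (net_tail \<Gamma> e) + offset \<Gamma> e\<bar> \<le> B"
    by (rule local_term_bound[of y]) blast
  define L where "L = (\<Sum>a\<in>marked \<Gamma>. \<bar>marking \<Gamma> a\<bar>)"
  \<comment> \<open>Chosen so that \<open>(1 - q) * K >= B\<close>, which absorbs the local term of
    an edge, and \<open>K >= L\<close>, which covers marked end nodes.\<close>
  define K where "K = B / (1 - q) + L"
  have L0: "0 \<le> L" unfolding L_def by (simp add: sum_nonneg)
  have K0: "0 \<le> K" unfolding K_def using L0 B(1) q by simp
  have fin: "finite (marked \<Gamma>)" using marked_subset finite_verts by (rule finite_subset)
  have base: "marking \<Gamma> a \<le> K * h a" if "a \<in> marked \<Gamma>" for a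
  proof -
    have "marking \<Gamma> a \<le> \<bar>marking \<Gamma> a\<bar>" by simp
    also have "\<dots> \<le> L" unfolding L_def using that fin by (intro member_le_sum) auto
    also have "\<dots> \<le> K" unfolding K_def using B(1) q by simp
    also have "\<dots> \<le> K * h a"
      using K0 h1[of a] that marked_subset mult_left_mono[of 1 "h a" K] by auto
    finally show ?thesis .
  qed
  have step: "node_val \<Gamma> y (net_tail \<Gamma> e) + offset \<Gamma> e + gain \<Gamma> e * s \<le> K * h (net_tail \<Gamma> e)"
    if e: "e \<in> arcs G" and s: "s \<le> K * h (net_head \<Gamma> e)" for e s
  proof -
    let ?v = "net_tail \<Gamma> e"
    have "node_val \<Gamma> y ?v + offset \<Gamma> e \<le> B" using B(2)[OF e] by simp
    also have "B \<le> (1 - q) * K" unfolding K_def using q L0 by (simp add: distrib_left)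
    also have "\<dots> \<le> (1 - q) * K * h ?v"
      using K0 q h1[of ?v] e mult_left_mono[of 1 "h ?v" "(1 - q) * K"] by auto
    finally have "node_val \<Gamma> y ?v + offset \<Gamma> e \<le> (1 - q) * K * h ?v" .
    moreover have "gain \<Gamma> e * s \<le> K * (gain \<Gamma> e * h (net_head \<Gamma> e))"
      using mult_left_mono[OF s, of "gain \<Gamma> e"] gain_pos[OF e] by (simp add: mult.left_commute)
    moreover have "K * (gain \<Gamma> e * h (net_head \<Gamma> e)) \<le> K * (q * h ?v)"
      using h[OF e] K0 by (rule mult_left_mono)
    ultimately show ?thesis by (simp add: algebra_simps)
  qed
  have finite_walk: "walk_sum \<Gamma> y (Finite_Walk u p) \<le> K * h u"
    if "awalk u p a" "a \<in> marked \<Gamma>" for u p a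
    using that
  proof (induction p arbitrary: u)
    case Nil
    then show ?case using base by (auto simp: walk_gain_def node_val_def awalk_Nil_iff)
  next
    case (Cons e p)
    then have e: "e \<in> arcs G" "net_tail \<Gamma> e = u" "awalk (net_head \<Gamma> e) p a"
      by (auto simp: awalk_Cons_iff)
    show ?case
      using step[OF e(1) Cons.IH[OF e(3) Cons.prems(2)]] e(2)
      by (simp only: walk_sum_Finite_Cons)
  qed
  \<comment> \<open>A truncated infinite walk contributes 0 at its end instead of a marking, so
    \<open>0 <= K * h\<close> starts this induction.\<close>
  have partial: "(\<Sum>k<n. walk_term \<Gamma> y e k) \<le> K * h (net_tail \<Gamma> (e 0))"
    if "\<And>k. e k \<in> arcs G" "\<And>k. net_head \<Gamma> (e k) = net_tail \<Gamma> (e (Suc k))" for e n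
    using that
  proof (induction n arbitrary: e)
    case 0
    then show ?case using K0 h1[of "net_tail \<Gamma> (e 0)"] by simp
  next
    case (Suc n)
    have "(\<Sum>k<n. walk_term \<Gamma> y (\<lambda>k. e (Suc k)) k) \<le> K * h (net_head \<Gamma> (e 0))"
      using Suc.IH[of "\<lambda>k. e (Suc k)"] Suc.prems by simp
    from step[OF Suc.prems(1) this] show ?case
      by (simp add: sum.lessThan_Suc_shift walk_term_Suc sum_distrib_left[symmetric]
          walk_term_def[of _ _ _ 0] del: sum.lessThan_Suc)
  qed
  have "walk_sum \<Gamma> y W \<le> K * h v" if W: "W \<in> walks_from \<Gamma> v" for W
  proof (cases W)
    case (Finite_Walk u p)
    then show ?thesis
      using W finite_walk[of v p] by (auto simp: Finite_Walk_in_walks_from simp del: walk_sum.simps)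
  next
    case (Infinite_Walk e)
    then have e: "Infinite_Walk e \<in> walks_from \<Gamma> v" using W by simp
    have "suminf (walk_term \<Gamma> y e) \<le> K * h (net_tail \<Gamma> (e 0))"
    proof (rule suminf_le_const)
      show "summable (walk_term \<Gamma> y e)"
        by (rule summable_rabs_cancel[OF walk_term_summable[OF e]])
      show "(\<Sum>k<n. walk_term \<Gamma> y e k) \<le> K * h (net_tail \<Gamma> (e 0))" for n
        using e by (intro partial) (auto simp: Infinite_Walk_in_walks_from)
    qed
    then show ?thesis
      using e Infinite_Walk by (simp add: Infinite_Walk_in_walks_from)
  qed
  then show ?thesis by (intro bdd_aboveI2)
qed

lemma walk_sup_well_defined: "walk_sup_well_defined \<Gamma>"
proof -
  have "Infinite_Walk e \<in> walks_from \<Gamma> (net_tail \<Gamma> (e 0))" if "Infinite_Walk e \<in> walks \<Gamma>" for e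
    using that by (simp add: walks_from_def)
  then show ?thesis
    unfolding walk_sup_well_defined_def
    by (auto simp: bdd_above_walk_sum walks_from_nonempty unmarked_def intro: walk_term_summable)
qed

section \<open>The Bellman equation for the supremum map\<close>

text \<open>The only walk from a marked node is empty and its sum is the marking. So the convention
  for marked nodes agrees with the supremum, and heads of edges can be treated alike.\<close>

lemma node_val_walk_sup_map:
  assumes "v \<in> verts G"
  shows "node_val \<Gamma> (walk_sup_map \<Gamma> y) v = (SUP W\<in>walks_from \<Gamma> v. walk_sum \<Gamma> y W)"
proof (cases "v \<in> marked \<Gamma>")
  case True
  then show ?thesis by (simp add: node_val_def walks_from_marked walk_gain_def)
next
  case False
  then show ?thesis using assms by (simp add: node_val_def walk_sup_map_def unmarked_def)
qed

text \<open>Each walk from \<open>v\<close> splits into an edge and a walk from its head, which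
  bounds the supremum above; prepending edges to arbitrary walks gives the reverse
  inequality.\<close>

lemma transfer_map_walk_sup_map:
  assumes "y \<in> coord_space V"
  shows "transfer_map \<Gamma> (walk_sup_map \<Gamma> y) = y"
proof -
  have "transfer_map \<Gamma> (walk_sup_map \<Gamma> y) v = y v" if v: "v \<in> V" for v
  proof -
    define S where "S u = (SUP W\<in>walks_from \<Gamma> u. walk_sum \<Gamma> y W)" for u
    define F where "F e = gain \<Gamma> e * S (net_head \<Gamma> e) + offset \<Gamma> e" for e
    have le_S: "walk_sum \<Gamma> y W \<le> S u" if "W \<in> walks_from \<Gamma> u" for W u
      unfolding S_def using that bdd_above_walk_sum by (rule cSUP_upper)
    have S_le: "S u \<le> b" if "u \<in> verts G" "\<And>W. W \<in> walks_from \<Gamma> u \<Longrightarrow> walk_sum \<Gamma> y W \<le> b" for u b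
      unfolding S_def using walks_from_nonempty[OF that(1)] that(2) by (rule cSUP_least)
    have "S v \<le> y v + Max (F ` out v)"
    proof (rule S_le)
      show "v \<in> verts G" using v by (simp add: unmarked_def)
      fix W assume "W \<in> walks_from \<Gamma> v"
      then obtain e W' where e: "e \<in> out v" "W' \<in> walks_from \<Gamma> (net_head \<Gamma> e)"
        "W = walk_cons e W'"
        by (rule walks_from_unmarked_cases[OF v])
      have "walk_sum \<Gamma> y W = y v + offset \<Gamma> e + gain \<Gamma> e * walk_sum \<Gamma> y W'"
        using walk_sum_walk_cons[OF v e(1,2)] e(3) by simp
      also have "\<dots> \<le> y v + F e"
        using mult_left_mono[OF le_S[OF e(2)], of "gain \<Gamma> e"] gain_pos[of e] e(1)
        by (simp add: F_def)
      also have "\<dots> \<le> y v + Max (F ` out v)" using e(1) finite_out by simp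
      finally show "walk_sum \<Gamma> y W \<le> y v + Max (F ` out v)" .
    qed
    moreover have "Max (F ` out v) \<le> S v - y v"
    proof (rule Max.boundedI)
      show "finite (F ` out v)" "F ` out v \<noteq> {}"
        using finite_out out_nonempty[OF v] by auto
      fix z assume "z \<in> F ` out v"
      then obtain e where e: "e \<in> out v" "z = F e" by blast
      have g: "0 < gain \<Gamma> e" using e(1) by (simp add: gain_pos)
      \<comment> \<open>Dividing by the positive gain turns the claim into an upper bound on a
        supremum, which can be checked on single walks.\<close>
      have "S (net_head \<Gamma> e) \<le> (S v - y v - offset \<Gamma> e) / gain \<Gamma> e"
      proof (rule S_le)
        show "net_head \<Gamma> e \<in> verts G" using e(1) by simp
        fix W assume W: "W \<in> walks_from \<Gamma> (net_head \<Gamma> e)"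
        show "walk_sum \<Gamma> y W \<le> (S v - y v - offset \<Gamma> e) / gain \<Gamma> e"
          using le_S[OF walk_cons_in_walks_from[OF v e(1) W]] walk_sum_walk_cons[OF v e(1) W] g
          by (simp add: le_divide_eq mult.commute)
      qed
      then show "z \<le> S v - y v" using g e(2) by (simp add: F_def le_divide_eq mult.commute)
    qed
    ultimately have "S v - Max (F ` out v) = y v" by simp
    moreover have "walk_sup_map \<Gamma> y v = S v" using v by (simp add: walk_sup_map_def S_def)
    moreover have "(\<lambda>e. gain \<Gamma> e * node_val \<Gamma> (walk_sup_map \<Gamma> y) (net_head \<Gamma> e) + offset \<Gamma> e) ` out v
        = F ` out v"
      by (intro image_cong) (auto simp: F_def S_def node_val_walk_sup_map)
    ultimately show ?thesis using transfer_map_apply[OF v] by simp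
  qed
  then show ?thesis
    using assms transfer_map_coord unfolding coord_space_def by (intro PiE_ext) auto
qed

lemma walk_sup_map_coord: "walk_sup_map \<Gamma> y \<in> coord_space V"
  by (simp add: walk_sup_map_def coord_space_def)

section \<open>Piecewise linearity of the transfer map\<close>

text \<open>Unmarked nodes contribute a unit coefficient vector, marked nodes only a constant
  term.\<close>

lemma node_val_affine:
  assumes "w \<in> verts G"
  shows "node_val \<Gamma> x w
    = (\<Sum>u\<in>V. (if u = w then 1 else 0) * x u) + (if w \<in> V then 0 else marking \<Gamma> w)"
proof -
  have "(\<Sum>u\<in>V. (if u = w then 1 else 0) * x u) = (if w \<in> V then x w else 0)"
    using finite_V by (simp add: if_distrib[of "\<lambda>z. z * _"] sum.delta cong: if_cong)
  then show ?thesis using assms by (auto simp: node_val_def unmarked_def)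
qed

lemma edge_value_affine:
  assumes "e \<in> arcs G"
  obtains a b where
    "\<And>x. gain \<Gamma> e * node_val \<Gamma> x (net_head \<Gamma> e) + offset \<Gamma> e = (\<Sum>u\<in>V. a u * x u) + b"
proof
  let ?w = "net_head \<Gamma> e"
  show "gain \<Gamma> e * node_val \<Gamma> x ?w + offset \<Gamma> e
    = (\<Sum>u\<in>V. (gain \<Gamma> e * (if u = ?w then 1 else 0)) * x u)
      + (gain \<Gamma> e * (if ?w \<in> V then 0 else marking \<Gamma> ?w) + offset \<Gamma> e)" for x
    using node_val_affine[of ?w x] assms
    by (simp only: mult.assoc sum_distrib_left[symmetric] distrib_left head_in_verts)
qed

text \<open>A piece \<open>P \<sigma>\<close> belongs to a choice of one outgoing edge per unmarked
  node and consists of the points where all chosen edges attain their maxima. There each maximum is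
  a single affine function.\<close>

lemma piecewise_linear_transfer_map: "piecewise_linear V (transfer_map \<Gamma>)"
proof -
  define f where "f x e = gain \<Gamma> e * node_val \<Gamma> x (net_head \<Gamma> e) + offset \<Gamma> e" for x e
  have "\<forall>e\<in>arcs G. \<exists>a b. \<forall>x. f x e = (\<Sum>u\<in>V. a u * x u) + b"
    unfolding f_def using edge_value_affine by metis
  then obtain a b where f: "\<And>x e. e \<in> arcs G \<Longrightarrow> f x e = (\<Sum>u\<in>V. a e u * x u) + b e"
    by metis
  define H where "H e e' = {x \<in> coord_space V. f x e \<le> f x e'}" for e e'
  have half: "halfspace V (H e e')" if "e \<in> arcs G" "e' \<in> arcs G" for e e'
    unfolding halfspace_def
  proof (intro exI)
    have "f x e \<le> f x e' \<longleftrightarrow> (\<Sum>u\<in>V. (a e u - a e' u) * x u) \<le> b e' - b e" for x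
      unfolding f[OF that(1)] f[OF that(2)] by (simp add: left_diff_distrib sum_subtractf) linarith
    then show "H e e' = {x \<in> coord_space V. (\<Sum>u\<in>V. (a e u - a e' u) * x u) \<le> b e' - b e}"
      unfolding H_def by simp
  qed
  define \<H> where "\<H> \<sigma> = (\<Union>v\<in>V. (\<lambda>e. H e (\<sigma> v)) ` out v)" for \<sigma>
  define P where "P \<sigma> = coord_space V \<inter> \<Inter>(\<H> \<sigma>)" for \<sigma>
  \<comment> \<open>Extensional choice functions keep the index set of the pieces finite.\<close>
  define \<P> where "\<P> = P ` (\<Pi>\<^sub>E v\<in>V. out v)"
  have "finite \<P>" unfolding \<P>_def using finite_V finite_out by (simp add: finite_PiE)
  moreover have "\<Union>\<P> = coord_space V"
  proof
    show "\<Union>\<P> \<subseteq> coord_space V" unfolding \<P>_def P_def by auto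
    show "coord_space V \<subseteq> \<Union>\<P>"
    proof
      fix x assume x: "x \<in> coord_space V"
      have "\<exists>e\<in>out v. \<forall>e'\<in>out v. f x e' \<le> f x e" if "v \<in> V" for v
      proof -
        have "Max (f x ` out v) \<in> f x ` out v"
          using finite_out out_nonempty[OF that] by simp
        then obtain e where e: "e \<in> out v" "f x e = Max (f x ` out v)"
          by (metis (no_types, lifting) imageE)
        have "f x e' \<le> f x e" if "e' \<in> out v" for e'
          unfolding e(2) using that finite_out by (intro Max_ge) auto
        then show ?thesis using e(1) by blast
      qed
      then obtain \<sigma> where \<sigma>: "\<And>v. v \<in> V \<Longrightarrow> \<sigma> v \<in> out v"
        "\<And>v e. v \<in> V \<Longrightarrow> e \<in> out v \<Longrightarrow> f x e \<le> f x (\<sigma> v)"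
        by metis
      \<comment> \<open>Restricting \<open>\<sigma>\<close> to \<open>V\<close> makes it
        extensional, hence an admissible index.\<close>
      have "x \<in> P (restrict \<sigma> V)"
        unfolding P_def \<H>_def H_def using x \<sigma>(2) by auto
      moreover have "restrict \<sigma> V \<in> (\<Pi>\<^sub>E v\<in>V. out v)" using \<sigma>(1) by auto
      ultimately show "x \<in> \<Union>\<P>" unfolding \<P>_def by blast
    qed
  qed
  moreover have "polyhedral V (P \<sigma>) \<and> affine_map_on V (P \<sigma>) (transfer_map \<Gamma>)"
    if \<sigma>: "\<sigma> \<in> (\<Pi>\<^sub>E v\<in>V. out v)" for \<sigma>
  proof
    have \<sigma>_out: "\<sigma> v \<in> out v" if "v \<in> V" for v using \<sigma> that by (rule PiE_mem)
    show "polyhedral V (P \<sigma>)"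
      unfolding polyhedral_def
    proof (intro exI conjI)
      show "finite (\<H> \<sigma>)" unfolding \<H>_def using finite_V finite_out by blast
      show "\<forall>H\<in>\<H> \<sigma>. halfspace V H" unfolding \<H>_def using \<sigma>_out by (auto intro!: half)
      show "P \<sigma> = coord_space V \<inter> \<Inter>(\<H> \<sigma>)" by (rule P_def)
    qed
    show "affine_map_on V (P \<sigma>) (transfer_map \<Gamma>)"
      unfolding affine_map_on_def
    proof (intro exI ballI)
      fix x v assume x: "x \<in> P \<sigma>" and v: "v \<in> V"
      have max: "Max (f x ` out v) = f x (\<sigma> v)"
      proof (rule Max_eqI)
        show "finite (f x ` out v)" using finite_out by simp
        show "f x (\<sigma> v) \<in> f x ` out v" using \<sigma>_out[OF v] by simp
        show "z \<le> f x (\<sigma> v)" if "z \<in> f x ` out v" for z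
          using x v that unfolding P_def \<H>_def H_def by auto
      qed
      have "x v = (\<Sum>u\<in>V. (if u = v then 1 else 0) * x u)"
        using finite_V v by (simp add: if_distrib[of "\<lambda>z. z * _"] sum.delta cong: if_cong)
      then have "transfer_map \<Gamma> x v
          = (\<Sum>u\<in>V. (if u = v then 1 else 0) * x u) - ((\<Sum>u\<in>V. a (\<sigma> v) u * x u) + b (\<sigma> v))"
        using transfer_map_apply[OF v, of x] max f[of "\<sigma> v" x] \<sigma>_out[OF v] unfolding f_def by simp
      also have "\<dots> = (\<Sum>u\<in>V. ((if u = v then 1 else 0) - a (\<sigma> v) u) * x u) + - b (\<sigma> v)"
        by (simp add: left_diff_distrib sum_subtractf)
      finally show "transfer_map \<Gamma> x v
          = (\<Sum>u\<in>V. ((if u = v then 1 else 0) - a (\<sigma> v) u) * x u) + - b (\<sigma> v)" .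
    qed
  qed
  ultimately show ?thesis
    unfolding piecewise_linear_def using transfer_map_coord
    by (intro conjI exI[of _ \<P>]) (auto simp: \<P>_def)
qed

section \<open>Bijectivity and the inverse\<close>

text \<open>Surjectivity comes from the right inverse \<open>walk_sup_map \<Gamma>\<close>.\<close>

lemma bij_betw_transfer_map: "bij_betw (transfer_map \<Gamma>) (coord_space V) (coord_space V)"
  using inj_on_transfer_map transfer_map_coord walk_sup_map_coord transfer_map_walk_sup_map
  unfolding bij_betw_def by (metis (no_types, lifting) image_subsetI rev_image_eqI subsetI subset_antisym)

text \<open>Injectivity upgrades the right inverse to the inverse.\<close>

lemma inv_into_transfer_map:
  "y \<in> coord_space V \<Longrightarrow> inv_into (coord_space V) (transfer_map \<Gamma>) y = walk_sup_map \<Gamma> y"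
  by (intro inv_into_f_eq inj_on_transfer_map walk_sup_map_coord transfer_map_walk_sup_map)

end

theorem theorem3p5:
  fixes \<Gamma> :: "('v, 'e) network"
  assumes "marked_network \<Gamma>"
    and "gainy \<Gamma>"
    and "all_sinks_marked \<Gamma>"
  shows "piecewise_linear (unmarked \<Gamma>) (transfer_map \<Gamma>)
    \<and> bij_betw (transfer_map \<Gamma>) (coord_space (unmarked \<Gamma>)) (coord_space (unmarked \<Gamma>))
    \<and> walk_sup_well_defined \<Gamma>
    \<and> (\<forall>y \<in> coord_space (unmarked \<Gamma>).
         inv_into (coord_space (unmarked \<Gamma>)) (transfer_map \<Gamma>) y = walk_sup_map \<Gamma> y)"
proof -
  interpret gainy_network \<Gamma>
    using assms by (intro gainy_network.intro gainy_network_axioms.intro)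
  show ?thesis
    using piecewise_linear_transfer_map bij_betw_transfer_map walk_sup_well_defined
      inv_into_transfer_map
    by blast
qed

end
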